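(* Let $N\ge2$, let $\mathcal{N}$ be a norm on $\mathbb{R}^N$, let $\Omega_0\subset\mathbb{R}^N$ be an open convex set, $\alpha\in[1,2)$ and $g\in C([0,+\infty))$. Then for each $h>0$ and each $n\in\mathbb{N}$ the set $\Omega^h_{nh}$ generated from $\Omega_0$ by the threshold dynamics scheme (described in the context) with forcing term $g$ is convex.
   Context: For $x\in\mathbb{R}^N$, $t>0$: $P_\alpha(x)=\frac{1}{1+\mathcal{N}(x)^{N+\alpha}}$, $p_\alpha(x,t)=t^{-N/\alpha}P_\alpha(xt^{-1/\alpha})$. For $h>0$, $\sigma_\alpha(h)=h^{\alpha/2}$ if $\alpha\in(1,2)$, while for $\alpha=1$, $\sigma_1(h)$ is defined by $h=\sigma_1(h)^2|\ln\sigma_1(h)|$ (small solution, $\sigma_1(h)\to0$ as $h\to0+$). $J_h(x)=p_\alpha(x,\sigma_\alpha(h))$; $\beta(\alpha,h)=h^{1/2}$ if $\alpha\in(1,2)$ and $\beta(1,h)=\sigma_1(h)|\ln\sigma_1(h)|$. Scheme (forcing depending only on time): $u_h(\cdot,0)=\mathbb{1}_{\Omega_0}-\mathbb{1}_{\overline{\Omega}_0^{\,c}}$, and $u_h(\cdot,(n+1)h)=\operatorname{sign}\big(J_h*u_h(\cdot,nh)+g(nh)\beta(\alpha,h)\big)$, where $\operatorname{sign}(s)=1$ if $s>0$ and $-1$ if $s\le0$. The open sets are $\Omega^h_0=\Omega_0$ and, for $n\ge1$, $\Omega^h_{nh}=\{x\in\mathbb{R}^N: J_h*u_h(\cdot,(n-1)h)(x)>-g((n-1)h)\beta(\alpha,h)\}$,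 so that $u_h(\cdot,nh)=\mathbb{1}_{\Omega^h_{nh}}-\mathbb{1}_{(\Omega^h_{nh})^c}$ for $n\geq 1$. *)

theory Defs
  imports "HOL-Analysis.Analysis" "HOL-Real_Asymp.Real_Asymp"
begin

definition is_norm :: "('a::real_vector \<Rightarrow> real) \<Rightarrow> bool" where
  "is_norm \<N> \<longleftrightarrow>
     (\<forall>x. \<N> x \<ge> 0) \<and> (\<forall>x. \<N> x = 0 \<longleftrightarrow> x = 0) \<and>
     (\<forall>c x. \<N> (c *\<^sub>R x) = \<bar>c\<bar> * \<N> x) \<and>
     (\<forall>x y. \<N> (x + y) \<le> \<N> x + \<N> y)"

definition P_kernel :: "(real ^ 'n \<Rightarrow> real) \<Rightarrow> real \<Rightarrow> real ^ 'n \<Rightarrow> real" where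
  "P_kernel \<N> \<alpha> x = 1 / (1 + \<N> x powr (real CARD('n) + \<alpha>))"

definition p_kernel :: "(real ^ 'n \<Rightarrow> real) \<Rightarrow> real \<Rightarrow> real ^ 'n \<Rightarrow> real \<Rightarrow> real" where
  "p_kernel \<N> \<alpha> x t =
     t powr (- real CARD('n) / \<alpha>) * P_kernel \<N> \<alpha> (t powr (- 1 / \<alpha>) *\<^sub>R x)"

(* For alpha = 1 the equation h = s^2 |ln s| has up to three positive solutions; the small one
   (tending to 0 with h) is the least. A least positive solution exists for every h > 0, see
   sigma_one below, so this also fixes a value when h > 1/(2e) and the only solution is > 1. *)
definition sigma :: "real \<Rightarrow> real \<Rightarrow> real" where
  "sigma \<alpha> h =
     (if \<alpha> = 1 then (LEAST s. s > 0 \<and> h = s\<^sup>2 * \<bar>ln s\<bar>) else h powr (\<alpha> / 2))"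

definition beta :: "real \<Rightarrow> real \<Rightarrow> real" where
  "beta \<alpha> h = (if \<alpha> = 1 then sigma 1 h * \<bar>ln (sigma 1 h)\<bar> else h powr (1 / 2))"

definition J_kernel :: "(real ^ 'n \<Rightarrow> real) \<Rightarrow> real \<Rightarrow> real \<Rightarrow> real ^ 'n \<Rightarrow> real" where
  "J_kernel \<N> \<alpha> h x = p_kernel \<N> \<alpha> x (sigma \<alpha> h)"

definition convolve :: "(real ^ 'n \<Rightarrow> real) \<Rightarrow> (real ^ 'n \<Rightarrow> real) \<Rightarrow> real ^ 'n \<Rightarrow> real" where
  "convolve f u x = (LINT y|lborel. f (x - y) * u y)"

(* Unlike sgn, this takes the value -1 at 0. *)
definition sign_lower :: "real \<Rightarrow> real" where
  "sign_lower s = (if s > 0 then 1 else - 1)"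

(* scheme_u \<N> \<alpha> g \<Omega>0 h n is the function u_h(., n h). *)
primrec scheme_u ::
  "(real ^ 'n \<Rightarrow> real) \<Rightarrow> real \<Rightarrow> (real \<Rightarrow> real) \<Rightarrow> (real ^ 'n) set \<Rightarrow> real \<Rightarrow> nat \<Rightarrow> real ^ 'n \<Rightarrow> real"
where
  "scheme_u \<N> \<alpha> g \<Omega>0 h 0 =
     (\<lambda>x. indicator \<Omega>0 x - indicator (- closure \<Omega>0) x)"
| "scheme_u \<N> \<alpha> g \<Omega>0 h (Suc n) =
     (\<lambda>x. sign_lower (convolve (J_kernel \<N> \<alpha> h) (scheme_u \<N> \<alpha> g \<Omega>0 h n) x
                      + g (real n * h) * beta \<alpha> h))"

(* scheme_set \<N> \<alpha> g \<Omega>0 h n is the set \<Omega>^h_{n h}. *)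
fun scheme_set ::
  "(real ^ 'n \<Rightarrow> real) \<Rightarrow> real \<Rightarrow> (real \<Rightarrow> real) \<Rightarrow> (real ^ 'n) set \<Rightarrow> real \<Rightarrow> nat \<Rightarrow> (real ^ 'n) set"
where
  "scheme_set \<N> \<alpha> g \<Omega>0 h 0 = \<Omega>0"
| "scheme_set \<N> \<alpha> g \<Omega>0 h (Suc n) =
     {x. convolve (J_kernel \<N> \<alpha> h) (scheme_u \<N> \<alpha> g \<Omega>0 h n) x
           > - g (real n * h) * beta \<alpha> h}"

lemma scheme_u_eq_indicator:
  assumes "n \<ge> 1"
  shows "scheme_u \<N> \<alpha> g \<Omega>0 h n x =
     indicator (scheme_set \<N> \<alpha> g \<Omega>0 h n) x - indicator (- scheme_set \<N> \<alpha> g \<Omega>0 h n) x"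
  using assms by (cases n) (auto simp: sign_lower_def indicator_def)

lemma continuous_on_sq_ln: "continuous_on {0..} (\<lambda>s::real. s\<^sup>2 * \<bar>ln s\<bar>)"
proof (unfold continuous_on_def, intro ballI)
  fix x :: real assume "x \<in> {0..}"
  show "((\<lambda>s. s\<^sup>2 * \<bar>ln s\<bar>) \<longlongrightarrow> x\<^sup>2 * \<bar>ln x\<bar>) (at x within {0..})"
  proof (cases "x = 0")
    case True
    have "((\<lambda>s::real. s\<^sup>2 * \<bar>ln s\<bar>) \<longlongrightarrow> 0) (at_right 0)" by real_asymp
    then show ?thesis using True by (simp add: at_within_Ici_at_right)
  next
    case False
    then show ?thesis by (auto intro!: tendsto_intros)
  qed
qed

lemma sigma_one_bound:
  assumes "h > 0" "b > 0" "h \<le> b\<^sup>2 * \<bar>ln b\<bar>"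
  shows "sigma 1 h > 0" "h = (sigma 1 h)\<^sup>2 * \<bar>ln (sigma 1 h)\<bar>" "sigma 1 h \<le> b"
    "\<And>s. s > 0 \<Longrightarrow> h = s\<^sup>2 * \<bar>ln s\<bar> \<Longrightarrow> sigma 1 h \<le> s"
proof -
  define f where "f = (\<lambda>s::real. s\<^sup>2 * \<bar>ln s\<bar>)"
  define S where "S = {s \<in> {0..b}. f s \<in> {h}}"
  have cont: "continuous_on {0..b} f"
    unfolding f_def by (rule continuous_on_subset[OF continuous_on_sq_ln]) auto
  have "closed S"
    unfolding S_def using continuous_closed_preimage[OF cont, of "{h}"]
    by (simp add: vimage_def Int_def conj_commute)
  moreover have "bounded S" unfolding S_def by (rule bounded_subset[of "{0..b}"]) auto
  ultimately have "compact S" by (simp add: compact_eq_bounded_closed)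
  have "\<exists>x. 0 \<le> x \<and> x \<le> b \<and> f x = h"
    using assms by (intro IVT' cont) (auto simp: f_def)
  then have "S \<noteq> {}" by (auto simp: S_def)
  obtain m where m: "m \<in> S" "\<And>s. s \<in> S \<Longrightarrow> m \<le> s"
    using compact_attains_inf[OF \<open>compact S\<close> \<open>S \<noteq> {}\<close>] by blast
  have m': "m > 0" "h = f m" "m \<le> b" using m(1) assms(1)
    by (auto simp: S_def f_def less_le)
  have min: "m \<le> s" if "s > 0" "h = f s" for s
    using m(2)[of s] m'(3) that by (cases "s \<le> b") (auto simp: S_def)
  have eq: "sigma 1 h = m"
    unfolding sigma_def using m' min by (auto simp: f_def intro!: Least_equality)
  show "sigma 1 h > 0" "h = (sigma 1 h)\<^sup>2 * \<bar>ln (sigma 1 h)\<bar>" "sigma 1 h \<le> b"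
    using m' eq by (simp_all add: f_def)
  show "sigma 1 h \<le> s" if "s > 0" "h = s\<^sup>2 * \<bar>ln s\<bar>" for s
    using min[of s] that eq by (simp add: f_def)
qed

lemma sigma_one:
  assumes "h > 0"
  shows "sigma 1 h > 0" "h = (sigma 1 h)\<^sup>2 * \<bar>ln (sigma 1 h)\<bar>"
    "\<And>s. s > 0 \<Longrightarrow> h = s\<^sup>2 * \<bar>ln s\<bar> \<Longrightarrow> sigma 1 h \<le> s"
proof -
  have "h * 1 \<le> (exp h)\<^sup>2 * \<bar>ln (exp h)\<bar>"
    using assms by (simp add: mult.commute one_le_power)
  then have "h \<le> (exp h)\<^sup>2 * \<bar>ln (exp h)\<bar>" by simp
  note * = sigma_one_bound[OF assms exp_gt_zero this]
  show "sigma 1 h > 0" "h = (sigma 1 h)\<^sup>2 * \<bar>ln (sigma 1 h)\<bar>"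
    "\<And>s. s > 0 \<Longrightarrow> h = s\<^sup>2 * \<bar>ln s\<bar> \<Longrightarrow> sigma 1 h \<le> s"
    by (fact *)+
qed

lemma sigma_one_tendsto_0: "(sigma 1 \<longlongrightarrow> 0) (at_right 0)"
proof (rule tendstoI)
  fix e :: real assume "e > 0"
  define b where "b = min (e / 2) (1 / 2)"
  have b: "b > 0" "b < 1" "b < e" using \<open>e > 0\<close> by (auto simp: b_def)
  then have "b\<^sup>2 * \<bar>ln b\<bar> > 0" by (intro mult_pos_pos) (auto simp: ln_less_zero)
  then have "eventually (\<lambda>h. h \<in> {0<..<b\<^sup>2 * \<bar>ln b\<bar>}) (at_right 0)"
    by (rule eventually_at_right_real)
  then show "eventually (\<lambda>h. dist (sigma 1 h) 0 < e) (at_right 0)"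
  proof eventually_elim
    case (elim h)
    then show ?case using sigma_one_bound[of h b] b by (auto simp: dist_norm)
  qed
qed

end

theory Submission
  imports Defs
begin

text \<open>
  Call a nonnegative function \<open>F\<close> power concave of order \<open>q\<close> if \<open>F\<close> to the power \<open>-1/q\<close> is convex (with
  value infinity where \<open>F = 0\<close>). The kernel \<open>J_h\<close> is power concave of order \<open>N + \<alpha>\<close>, because
  \<open>(1 + r^p)^(1/p)\<close> is the \<open>l^p\<close> norm of \<open>(1, r)\<close>. Integrating out one real variable turns order \<open>q\<close>
  into order \<open>q - 1\<close> as long as \<open>q > 1\<close> (the one-dimensional Borell-Brascamp-Lieb inequality).
  Applied to the \<open>N\<close> coordinates of \<open>y\<close> in \<open>J_h(x - y) 1_S(y)\<close> with \<open>S\<close> convex, this shows that \<open>J_h * 1_S\<close>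
  is power concave of order \<open>\<alpha> > 0\<close>, so that its superlevel sets are convex. The next set of the
  scheme is such a superlevel set, since \<open>J_h * (1_S - 1_(S^c)) = 2 J_h * 1_S - \<integral>J_h\<close>.
\<close>

section \<open>Jensen and Brunn-Minkowski inequalities on the real line\<close>

text \<open>Jensen's inequality for \<open>x^q\<close> at \<open>a/A\<close> and \<open>b/B\<close> with weights proportional to \<open>uA\<close> and \<open>vB\<close>.\<close>

lemma weighted_powr_le:
  fixes q u v a b A B :: real
  assumes "q \<ge> 1" "u > 0" "v > 0" "a > 0" "b > 0" "A > 0" "B > 0"
  shows "(u * a + v * b) powr q \<le>
    (u * A + v * B) powr (q - 1) * (u * A * (a / A) powr q + v * B * (b / B) powr q)"
proof -
  define C where "C = u * A + v * B"
  have C: "C > 0" using assms by (simp add: C_def add_pos_pos)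
  have w: "u * A / C + v * B / C = 1" "u * A / C \<ge> 0" "v * B / C \<ge> 0"
    using C assms by (auto simp: C_def add_divide_distrib[symmetric])
  have "(s * y + t * z) powr q \<le> s * y powr q + t * z powr q"
    if "s + t = 1" "s \<ge> 0" "t \<ge> 0" "y > 0" "z > 0" for s t y z
    using powr_convex[OF assms(1)] that by (simp add: convex_on_def)
  from this[OF w, of "a / A" "b / B"]
  have "(u * A / C * (a / A) + v * B / C * (b / B)) powr q
      \<le> u * A / C * (a / A) powr q + v * B / C * (b / B) powr q"
    using assms by simp
  also have "u * A / C * (a / A) + v * B / C * (b / B) = (u * a + v * b) / C"
    using assms C by (simp add: field_simps)
  also have "((u * a + v * b) / C) powr q = (u * a + v * b) powr q / C powr q"
    using assms C by (simp add: powr_divide)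
  finally have "(u * a + v * b) powr q \<le>
      C powr q * (u * A / C * (a / A) powr q + v * B / C * (b / B) powr q)"
    using C by (simp add: field_simps)
  also have "\<dots> = C powr q / C * (u * A * (a / A) powr q + v * B * (b / B) powr q)"
    using C by (simp add: field_simps)
  also have "C powr q / C = C powr (q - 1)"
    using C by (simp add: powr_diff)
  finally show ?thesis by (simp add: C_def)
qed

text \<open>A set whose points are pairwise closer than \<open>r - e\<close> lies in a closed
  interval of that length starting at its infimum, so its measure is below \<open>r\<close>. The
  slack \<open>e\<close> is there because the endpoints need not belong to the set; the real
  \<open>r\<close> gives access to sets of infinite measure through finite lower bounds.\<close>

lemma convex_real_diameter_ge:
  fixes S :: "real set"
  assumes "S \<noteq> {}" "0 \<le> r" "ennreal r \<le> emeasure lborel S" "e > 0"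
  obtains a b where "a \<in> S" "b \<in> S" "a \<le> b" "r - e \<le> b - a"
proof (cases "r - e \<le> 0")
  case True
  then show ?thesis using assms(1) that by force
next
  case False
  have "\<exists>a\<in>S. \<exists>b\<in>S. r - e \<le> b - a"
  proof (rule ccontr)
    assume "\<not> ?thesis"
    then have *: "b - a < r - e" if "a \<in> S" "b \<in> S" for a b using that by force
    obtain s where s: "s \<in> S" using assms(1) by auto
    have bdd: "bdd_below S"
    proof (rule bdd_belowI)
      show "s - (r - e) \<le> x" if "x \<in> S" for x using *[OF that s] by simp
    qed
    have "S \<subseteq> {Inf S..Inf S + (r - e)}"
    proof
      fix x assume x: "x \<in> S"
      have "x - (r - e) \<le> Inf S"
        using *[OF _ x] by (intro cInf_greatest assms(1)) (auto intro: less_imp_le simp: algebra_simps)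
      then show "x \<in> {Inf S..Inf S + (r - e)}" using cInf_lower[OF x bdd] by simp
    qed
    then have "emeasure lborel S \<le> emeasure lborel {Inf S..Inf S + (r - e)}"
      by (intro emeasure_mono) auto
    also have "\<dots> = ennreal (r - e)" using False by simp
    also have "\<dots> < ennreal r" using assms False by (simp add: ennreal_lessI)
    finally show False using assms(3) by simp
  qed
  then show ?thesis using False that by force
qed

text \<open>Convex sets of reals are intervals: a segment in \<open>A\<close> and one in
  \<open>B\<close> combine to a segment in \<open>C\<close> whose length is the same combination of
  the two lengths. Segments nearly as long as the measures of \<open>A\<close> and \<open>B\<close>
  give the inequality.\<close>

lemma Brunn_Minkowski_convex_real:
  fixes A B C :: "real set"
  assumes conv: "convex A" "convex B" and ne: "A \<noteq> {}" "B \<noteq> {}"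
    and C: "C \<in> sets borel" and uv: "u > 0" "v > 0"
    and sub: "\<And>a b. a \<in> A \<Longrightarrow> b \<in> B \<Longrightarrow> u * a + v * b \<in> C"
  shows "ennreal u * emeasure lborel A + ennreal v * emeasure lborel B \<le> emeasure lborel C"
proof -
  have seg: "ennreal (u * (a2 - a1) + v * (b2 - b1)) \<le> emeasure lborel C"
    if "a1 \<in> A" "a2 \<in> A" "a1 \<le> a2" "b1 \<in> B" "b2 \<in> B" "b1 \<le> b2" for a1 a2 b1 b2
  proof -
    let ?p = "u * a1 + v * b1" and ?q = "u * a2 + v * b2"
    have le: "?p \<le> ?q" using that uv by (intro add_mono mult_left_mono) auto
    have "closed_segment ?p ?q \<subseteq> C"
    proof
      fix x assume "x \<in> closed_segment ?p ?q"
      then obtain w where w: "0 \<le> w" "w \<le> 1" "x = (1 - w) *\<^sub>R ?p + w *\<^sub>R ?q"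
        by (auto simp: closed_segment_def)
      have "(1 - w) *\<^sub>R a1 + w *\<^sub>R a2 \<in> A" "(1 - w) *\<^sub>R b1 + w *\<^sub>R b2 \<in> B"
        using conv that w by (auto simp: convex_alt)
      from sub[OF this] show "x \<in> C" by (simp add: w(3) algebra_simps)
    qed
    then have "emeasure lborel {?p..?q} \<le> emeasure lborel C"
      using le C by (intro emeasure_mono) (auto simp: closed_segment_eq_real_ivl)
    then show ?thesis using le by (simp add: algebra_simps)
  qed
  have fin: "ennreal (u * r + v * s) \<le> emeasure lborel C"
    if r: "0 \<le> r" "ennreal r \<le> emeasure lborel A" and s: "0 \<le> s" "ennreal s \<le> emeasure lborel B" for r s
  proof (rule ennreal_le_epsilon)
    fix e :: real assume e: "0 < e"
    \<comment> \<open>A loss of \<open>d\<close> in each of the two lengths costs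
      \<open>(u + v) * d = e\<close> in the combination.\<close>
    define d where "d = e / (u + v)"
    have d: "d > 0" "e = (u + v) * d" using e uv by (auto simp: d_def)
    obtain a1 a2 where a: "a1 \<in> A" "a2 \<in> A" "a1 \<le> a2" "r - d \<le> a2 - a1"
      using convex_real_diameter_ge[OF ne(1) r d(1)] by blast
    obtain b1 b2 where b: "b1 \<in> B" "b2 \<in> B" "b1 \<le> b2" "s - d \<le> b2 - b1"
      using convex_real_diameter_ge[OF ne(2) s d(1)] by blast
    have "u * (r - d) + v * (s - d) \<le> u * (a2 - a1) + v * (b2 - b1)"
      using uv a(4) b(4) by (intro add_mono mult_left_mono) auto
    then have "ennreal (u * r + v * s) \<le> ennreal ((u * (a2 - a1) + v * (b2 - b1)) + e)"
      by (intro ennreal_leI) (simp add: d(2) algebra_simps)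
    also have "\<dots> = ennreal (u * (a2 - a1) + v * (b2 - b1)) + ennreal e"
      using e a b uv by (intro ennreal_plus) auto
    also have "\<dots> \<le> emeasure lborel C + ennreal e"
      by (intro add_right_mono seg a b)
    finally show "ennreal (u * r + v * s) \<le> emeasure lborel C + ennreal e" .
  qed
  have top: "emeasure lborel C = top" if w: "w > 0" and le: "\<And>r. 0 \<le> r \<Longrightarrow> ennreal (w * r) \<le> emeasure lborel C" for w
  proof (rule ccontr)
    assume "emeasure lborel C \<noteq> top"
    then obtain c where c: "0 \<le> c" "emeasure lborel C = ennreal c"
      by (metis ennreal_cases)
    have "ennreal (w * ((c + 1) / w)) \<le> ennreal c"
      using le[of "(c + 1) / w"] w c by simp
    then show False using w c by simp
  qed
  show ?thesis
  proof (cases "emeasure lborel A = top \<or> emeasure lborel B = top")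
    case True
    \<comment> \<open>If one set has infinite measure, \<open>fin\<close> applies with every
      nonnegative real for that set and \<open>0\<close> for the other, so the measure of
      \<open>C\<close> has arbitrarily large lower bounds.\<close>
    then have "emeasure lborel C = top"
      using fin[of _ 0] fin[of 0] top[of u] top[of v] uv by auto
    then show ?thesis by simp
  next
    case False
    then obtain r s where rs: "0 \<le> r" "emeasure lborel A = ennreal r" "0 \<le> s" "emeasure lborel B = ennreal s"
      by (metis ennreal_cases)
    then show ?thesis using fin[of r s] uv by (simp add: ennreal_mult ennreal_plus)
  qed
qed

section \<open>Layer cake, truncation and the one-dimensional Borell-Brascamp-Lieb
  inequality\<close>

text \<open>\<open>min y c\<close> is \<open>c\<close> times the length of the set of
  \<open>t\<close> in \<open>(0, 1)\<close> with \<open>c * t < y\<close>; Tonelli's theorem then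
  exchanges the integrals. Scaling the levels to \<open>(0, 1)\<close> allows functions truncated at
  different heights to be compared at the same \<open>t\<close>.\<close>

lemma nn_integral_min_layer_cake:
  fixes f :: "'a \<Rightarrow> ennreal"
  assumes "sigma_finite_measure M" and f[measurable]: "f \<in> borel_measurable M" and c: "c > 0"
  shows "(\<integral>\<^sup>+x. min (f x) (ennreal c) \<partial>M) =
    ennreal c * (\<integral>\<^sup>+t. indicator {0<..<1} t * emeasure M {x \<in> space M. ennreal (c * t) < f x} \<partial>lborel)"
proof -
  interpret sigma_finite_measure M by fact
  interpret pair_sigma_finite M "lborel :: real measure"
    by (intro pair_sigma_finite.intro assms(1) lborel.sigma_finite_measure_axioms)
  have pt: "min (y::ennreal) (ennreal c) =
      ennreal c * (\<integral>\<^sup>+t. indicator {0<..<1} t * indicator {t. ennreal (c * t) < y} t \<partial>lborel)" for y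
  proof (cases y)
    case (real r)
    have "indicator {0<..<1} t * indicator {t. ennreal (c * t) < y} t = (indicator {0<..<min 1 (r / c)} t :: ennreal)" for t
      using c real by (auto simp: indicator_def ennreal_less_iff field_simps)
    then show ?thesis using real c
      by (simp add: ennreal_mult[symmetric] min_def ennreal_le_iff field_simps)
  next
    case top
    then show ?thesis by (simp add: min_def top_unique)
  qed
  have "(\<integral>\<^sup>+x. min (f x) (ennreal c) \<partial>M) =
      ennreal c * (\<integral>\<^sup>+x. \<integral>\<^sup>+t. indicator {0<..<1} t * indicator {t. ennreal (c * t) < f x} t \<partial>lborel \<partial>M)"
    by (subst pt, subst nn_integral_cmult) (auto simp: indicator_def)
  also have "(\<integral>\<^sup>+x. \<integral>\<^sup>+t. indicator {0<..<1} t * indicator {t. ennreal (c * t) < f x} t \<partial>lborel \<partial>M) =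
     (\<integral>\<^sup>+t. \<integral>\<^sup>+x. indicator {0<..<1} t * indicator {t. ennreal (c * t) < f x} t \<partial>M \<partial>lborel)"
    by (rule Fubini'[symmetric]) (simp add: indicator_def)
  also have "\<dots> = (\<integral>\<^sup>+t. indicator {0<..<1} t * emeasure M {x \<in> space M. ennreal (c * t) < f x} \<partial>lborel)"
  proof (rule nn_integral_cong)
    fix t :: real
    have "(\<integral>\<^sup>+x. indicator {0<..<1} t * indicator {t. ennreal (c * t) < f x} t \<partial>M) =
      (\<integral>\<^sup>+x. indicator {0<..<1} t * indicator {x \<in> space M. ennreal (c * t) < f x} x \<partial>M)"
      by (rule nn_integral_cong) (auto simp: indicator_def)
    then show "(\<integral>\<^sup>+x. indicator {0<..<1} t * indicator {t. ennreal (c * t) < f x} t \<partial>M) =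
      indicator {0<..<1} t * emeasure M {x \<in> space M. ennreal (c * t) < f x}"
      by (simp add: nn_integral_cmult)
  qed
  finally show ?thesis .
qed

text \<open>Truncations at a sequence of levels increasing to the supremum of \<open>f\<close>
  converge monotonically to \<open>f\<close>, so one of them already has integral above
  \<open>c\<close>. Levels strictly below the supremum keep the set where \<open>f\<close> exceeds
  \<open>a\<close> nonempty, as Brunn-Minkowski requires.\<close>

lemma nn_integral_truncate_less:
  fixes f :: "'a \<Rightarrow> ennreal"
  assumes [measurable]: "f \<in> borel_measurable M" and less: "c < (\<integral>\<^sup>+x. f x \<partial>M)"
  obtains a where "a > 0" "\<exists>x. ennreal a < f x" "c < (\<integral>\<^sup>+x. min (f x) (ennreal a) \<partial>M)"
proof -
  define S where "S = (SUP x. f x)"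
  have "S \<noteq> 0"
  proof
    assume "S = 0"
    then have "f x = 0" for x using SUP_upper[of x UNIV f] by (simp add: S_def)
    then show False using less by simp
  qed
  then have "0 \<in> {..<S}" by (simp add: zero_less_iff_neq_zero)
  then have "{..<S} \<noteq> {}" by blast
  from ennreal_Sup_countable_SUP[OF this]
  obtain m :: "nat \<Rightarrow> ennreal" where m: "incseq m" "range m \<subseteq> {..<S}" "S = (SUP i. m i)"
    by auto
  have eq: "f x = (SUP i. min (f x) (m i))" for x
  proof -
    have "(SUP i. min (f x) (m i)) = min (f x) S"
      unfolding m(3) by (simp add: inf_min[symmetric] inf_SUP)
    then show ?thesis by (simp add: min_def S_def SUP_upper)
  qed
  have "(\<integral>\<^sup>+x. f x \<partial>M) = (\<integral>\<^sup>+x. (SUP i. min (f x) (m i)) \<partial>M)"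
    by (subst eq) (rule refl)
  also have "\<dots> = (SUP i. \<integral>\<^sup>+x. min (f x) (m i) \<partial>M)"
  proof (rule nn_integral_monotone_convergence_SUP)
    show "incseq (\<lambda>i x. min (f x) (m i))"
      using m(1) by (auto simp: incseq_def le_fun_def min_le_iff_disj)
  qed auto
  finally obtain i where i: "c < (\<integral>\<^sup>+x. min (f x) (m i) \<partial>M)"
    using less by (auto simp: less_SUP_iff)
  have "m i < S" using m(2) by auto
  then have "m i < top" using order.strict_trans2 top_greatest by blast
  then obtain a where a: "0 \<le> a" "m i = ennreal a" by (cases "m i") auto
  have "a \<noteq> 0"
  proof
    assume "a = 0"
    then have "(\<integral>\<^sup>+x. min (f x) (m i) \<partial>M) = 0" using a by (simp add: min.absorb2)
    then show False using i by simp
  qed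
  moreover have "\<exists>x. ennreal a < f x" using \<open>m i < S\<close> a by (auto simp: S_def less_SUP_iff)
  ultimately show ?thesis using that[of a] i a by simp
qed

text \<open>
  After truncating \<open>f\<close> and \<open>g\<close> at levels \<open>\<alpha>\<close> and \<open>\<beta>\<close> below their suprema, the level sets \<open>{f > \<alpha> t}\<close> and
  \<open>{g > \<beta> t}\<close> are nonempty intervals for the same range \<open>0 < t < 1\<close>, so Brunn-Minkowski on the line
  applies for every \<open>t\<close> and is integrated by the layer cake formula.
\<close>

lemma marginal_power_concave_real:
  fixes f g h :: "real \<Rightarrow> ennreal"
  assumes [measurable]: "f \<in> borel_measurable borel" "g \<in> borel_measurable borel" "h \<in> borel_measurable borel"
    and q: "q > 1" and uv: "u > 0" "v > 0" and AB: "A > 0" "B > 0"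
    and convf: "\<And>c. c > 0 \<Longrightarrow> convex {s. ennreal c < f s}"
    and convg: "\<And>c. c > 0 \<Longrightarrow> convex {s. ennreal c < g s}"
    and fgh: "\<And>s t a b. a > 0 \<Longrightarrow> b > 0 \<Longrightarrow> ennreal (a powr -q) < f s \<Longrightarrow> ennreal (b powr -q) < g t \<Longrightarrow>
       ennreal ((u * a + v * b) powr -q) < h (u * s + v * t)"
    and F: "ennreal (A powr -(q - 1)) < (\<integral>\<^sup>+s. f s \<partial>lborel)"
    and G: "ennreal (B powr -(q - 1)) < (\<integral>\<^sup>+s. g s \<partial>lborel)"
  shows "ennreal ((u * A + v * B) powr -(q - 1)) < (\<integral>\<^sup>+s. h s \<partial>lborel)"
proof -
  obtain \<alpha> where \<alpha>: "\<alpha> > 0" "\<exists>s. ennreal \<alpha> < f s"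
      "ennreal (A powr -(q - 1)) < (\<integral>\<^sup>+s. min (f s) (ennreal \<alpha>) \<partial>lborel)"
    using nn_integral_truncate_less[OF _ F] by auto
  obtain \<beta> where \<beta>: "\<beta> > 0" "\<exists>s. ennreal \<beta> < g s"
      "ennreal (B powr -(q - 1)) < (\<integral>\<^sup>+s. min (g s) (ennreal \<beta>) \<partial>lborel)"
    using nn_integral_truncate_less[OF _ G] by auto
  \<comment> \<open>The parameters whose powers \<open>-q\<close> are the truncation levels;
    \<open>C\<close> is the level of \<open>h\<close> that \<open>fgh\<close> assigns to
    them.\<close>
  define a where "a = \<alpha> powr (-1 / q)"
  define b where "b = \<beta> powr (-1 / q)"
  define C where "C = (u * a + v * b) powr -q"
  have ab: "a > 0" "b > 0" "a powr -q = \<alpha>" "b powr -q = \<beta>"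
    using \<alpha>(1) \<beta>(1) q by (auto simp: a_def b_def powr_powr)
  have "u * a + v * b > 0" using ab uv by (simp add: add_pos_pos)
  then have C: "C > 0" by (simp add: C_def)
  define L where "L = (\<lambda>k c t. emeasure lborel {s :: real. ennreal (c * t) < k s})"
  define I where "I = (\<lambda>k c. \<integral>\<^sup>+t. indicator {0<..<1} t * L k c t \<partial>lborel)"
  have L_meas: "L k c \<in> borel_measurable borel" if [measurable]: "k \<in> borel_measurable borel" for k c
  proof -
    have "L k c = (\<lambda>t. \<integral>\<^sup>+s. indicator {s. ennreal (c * t) < k s} s \<partial>lborel)"
      unfolding L_def by (intro ext nn_integral_indicator[symmetric]) simp
    also have "\<dots> \<in> borel_measurable borel"
      unfolding indicator_def by measurable
    finally show ?thesis .
  qed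
  note [measurable] = L_meas[OF assms(1)] L_meas[OF assms(2)]
  have cake: "(\<integral>\<^sup>+s. min (k s) (ennreal c) \<partial>lborel) = ennreal c * I k c"
    if "k \<in> borel_measurable borel" "c > 0" for k c
    using nn_integral_min_layer_cake[OF lborel.sigma_finite_measure_axioms _ that(2), of k] that(1)
    by (simp add: I_def L_def)
  have BM: "ennreal u * L f \<alpha> t + ennreal v * L g \<beta> t \<le> L h C t" if t: "0 < t" "t < 1" for t
    unfolding L_def
  proof (rule Brunn_Minkowski_convex_real)
    have less: "ennreal (c * t) < ennreal c" if "c > 0" for c
      using t that by (simp add: ennreal_less_iff)
    show "{s. ennreal (\<alpha> * t) < f s} \<noteq> {}" "{s. ennreal (\<beta> * t) < g s} \<noteq> {}"
      using \<alpha> \<beta> less[of \<alpha>] less[of \<beta>] less_trans by blast+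
    \<comment> \<open>Multiplying both parameters by \<open>k\<close> multiplies all three levels by
      \<open>t\<close>, so \<open>fgh\<close> compares the level sets of \<open>f\<close>,
      \<open>g\<close> and \<open>h\<close> at one and the same \<open>t\<close>.\<close>
    define k where "k = t powr (-1 / q)"
    have k: "k > 0" "k powr -q = t" using t q by (auto simp: k_def powr_powr)
    have scale: "(c * k) powr -q = c powr -q * t" if "c > 0" for c
      using k that by (simp add: powr_mult)
    fix s s' assume s: "s \<in> {s. ennreal (\<alpha> * t) < f s}" "s' \<in> {s. ennreal (\<beta> * t) < g s}"
    have "ennreal ((u * (a * k) + v * (b * k)) powr -q) < h (u * s + v * s')"
      using s ab k scale[of a] scale[of b] by (intro fgh) auto
    also have "u * (a * k) + v * (b * k) = (u * a + v * b) * k" by (simp add: algebra_simps)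
    also have "\<dots> powr -q = C * t" using ab uv by (subst scale) (simp_all add: C_def add_pos_pos)
    finally show "u * s + v * s' \<in> {s. ennreal (C * t) < h s}" by simp
  qed (use \<alpha>(1) \<beta>(1) t uv in \<open>auto intro!: convf convg\<close>)
  have D: "u * A + v * B > 0" using uv AB by (simp add: add_pos_pos)
  \<comment> \<open>Jensen's inequality with weights coming from \<open>A\<close> and
    \<open>B\<close> becomes, after inversion, the bound \<open>key\<close>, in which the order has
    dropped to \<open>q - 1\<close>.\<close>
  have "(u * a + v * b) powr q \<le>
      (u * A + v * B) powr (q - 1) * (u * A * (a / A) powr q + v * B * (b / B) powr q)"
    using q uv ab AB by (intro weighted_powr_le) auto
  also have "u * A * (a / A) powr q = u * (A powr -(q - 1) / \<alpha>)"
    using AB ab(1) by (simp add: ab(3)[symmetric] powr_divide powr_minus powr_diff divide_simps)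
  also have "v * B * (b / B) powr q = v * (B powr -(q - 1) / \<beta>)"
    using AB ab(2) by (simp add: ab(4)[symmetric] powr_divide powr_minus powr_diff divide_simps)
  finally have le: "(u * a + v * b) powr q \<le> (u * A + v * B) powr (q - 1) *
      (u * (A powr -(q - 1) / \<alpha>) + v * (B powr -(q - 1) / \<beta>))" .
  have "1 / d \<le> 1 / e * S" if "e \<le> d * S" "0 < d" "0 < e" for d e S :: real
    using that by (simp add: field_simps)
  from this[OF le] have key: "(u * A + v * B) powr -(q - 1) \<le>
      C * (u * (A powr -(q - 1) / \<alpha>) + v * (B powr -(q - 1) / \<beta>))"
    using D \<open>u * a + v * b > 0\<close> by (simp add: C_def powr_minus_divide del: minus_diff_eq)
  have "ennreal (A powr -(q - 1) / \<alpha>) < I f \<alpha>"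
  proof (cases "I f \<alpha>")
    case (real r)
    then have "A powr -(q - 1) < \<alpha> * r"
      using \<alpha>(1,3) by (simp add: cake ennreal_mult[symmetric] ennreal_less_iff)
    then show ?thesis using real \<alpha>(1) by (simp add: ennreal_less_iff field_simps)
  qed simp
  moreover have "ennreal (B powr -(q - 1) / \<beta>) < I g \<beta>"
  proof (cases "I g \<beta>")
    case (real r)
    then have "B powr -(q - 1) < \<beta> * r"
      using \<beta>(1,3) by (simp add: cake ennreal_mult[symmetric] ennreal_less_iff)
    then show ?thesis using real \<beta>(1) by (simp add: ennreal_less_iff field_simps)
  qed simp
  moreover have combine: "ennreal (C * (u * x + v * y)) < ennreal C * (ennreal u * X + ennreal v * Y)"
    if "ennreal x < X" "ennreal y < Y" "0 \<le> x" "0 \<le> y" for x y X Y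
  proof (cases "X = top \<or> Y = top")
    case True
    then show ?thesis using C uv by (auto simp: ennreal_mult_eq_top_iff)
  next
    case False
    then obtain r s where rs: "0 \<le> r" "X = ennreal r" "0 \<le> s" "Y = ennreal s"
      by (metis ennreal_cases)
    then have "x < r" "y < s" using that by (auto simp: ennreal_less_iff)
    then have "C * (u * x + v * y) < C * (u * r + v * s)"
      using C uv by (intro mult_strict_left_mono add_strict_mono) auto
    moreover have "ennreal C * (ennreal u * X + ennreal v * Y) = ennreal (C * (u * r + v * s))"
      using rs C uv by (simp add: ennreal_mult ennreal_plus)
    ultimately show ?thesis using that C uv by (simp add: ennreal_less_iff)
  qed
  ultimately have "ennreal (C * (u * (A powr -(q - 1) / \<alpha>) + v * (B powr -(q - 1) / \<beta>)))
      < ennreal C * (ennreal u * I f \<alpha> + ennreal v * I g \<beta>)"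
    using \<alpha>(1) \<beta>(1) by (intro combine) auto
  also have "ennreal C * (ennreal u * I f \<alpha> + ennreal v * I g \<beta>) \<le> ennreal C * I h C"
  proof (rule mult_left_mono)
    have "ennreal u * I f \<alpha> + ennreal v * I g \<beta> =
        (\<integral>\<^sup>+t. indicator {0<..<1} t * (ennreal u * L f \<alpha> t + ennreal v * L g \<beta> t) \<partial>lborel)"
      unfolding I_def
      by (simp add: nn_integral_cmult[symmetric] nn_integral_add[symmetric] distrib_left mult.left_commute)
    also have "\<dots> \<le> I h C"
      unfolding I_def
    proof (rule nn_integral_mono)
      show "indicator {0<..<1} t * (ennreal u * L f \<alpha> t + ennreal v * L g \<beta> t) \<le>
          indicator {0<..<1} t * L h C t" for t :: real
        by (cases "0 < t \<and> t < 1") (auto simp: indicator_def BM)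
    qed
    finally show "ennreal u * I f \<alpha> + ennreal v * I g \<beta> \<le> I h C" .
  qed simp
  also have "ennreal C * I h C = (\<integral>\<^sup>+s. min (h s) (ennreal C) \<partial>lborel)"
    using C by (simp add: cake)
  also have "\<dots> \<le> (\<integral>\<^sup>+s. h s \<partial>lborel)"
    by (intro nn_integral_mono) simp
  finally show ?thesis
    using order.strict_trans1[OF ennreal_leI[OF key]] by simp
qed

section \<open>Power concavity under integration\<close>

text \<open>
  \<open>ennreal (a powr -q) < F x\<close> says that \<open>a\<close> exceeds \<open>F x\<close> to the power \<open>-1/q\<close>: this is convexity of
  the strict epigraph, and it treats the values \<open>0\<close> and \<open>\<infinity>\<close> of \<open>F\<close> correctly.
\<close>

definition power_concave :: "real \<Rightarrow> ('p::real_vector \<Rightarrow> ennreal) \<Rightarrow> bool" where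
  "power_concave q F \<longleftrightarrow> (\<forall>x y u v a b. u > 0 \<longrightarrow> v > 0 \<longrightarrow> u + v = 1 \<longrightarrow> a > 0 \<longrightarrow> b > 0 \<longrightarrow>
     ennreal (a powr -q) < F x \<longrightarrow> ennreal (b powr -q) < F y \<longrightarrow>
     ennreal ((u * a + v * b) powr -q) < F (u *\<^sub>R x + v *\<^sub>R y))"

lemma power_concaveD:
  assumes "power_concave q F" "u > 0" "v > 0" "u + v = 1" "a > 0" "b > 0"
    "ennreal (a powr -q) < F x" "ennreal (b powr -q) < F y"
  shows "ennreal ((u * a + v * b) powr -q) < F (u *\<^sub>R x + v *\<^sub>R y)"
  using assms unfolding power_concave_def by blast

text \<open>The second variable is a family of coordinates, whose convex combinations are formed
  pointwise. Extensional families are the points of the product measure over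
  \<open>I\<close>.\<close>

definition power_concave_PiM :: "real \<Rightarrow> 'i set \<Rightarrow> ('p::real_vector \<Rightarrow> ('i \<Rightarrow> real) \<Rightarrow> ennreal) \<Rightarrow> bool" where
  "power_concave_PiM q I K \<longleftrightarrow> (\<forall>x y w z u v a b. w \<in> extensional I \<longrightarrow> z \<in> extensional I \<longrightarrow>
     u > 0 \<longrightarrow> v > 0 \<longrightarrow> u + v = 1 \<longrightarrow> a > 0 \<longrightarrow> b > 0 \<longrightarrow>
     ennreal (a powr -q) < K x w \<longrightarrow> ennreal (b powr -q) < K y z \<longrightarrow>
     ennreal ((u * a + v * b) powr -q) < K (u *\<^sub>R x + v *\<^sub>R y) (\<lambda>i. u * w i + v * z i))"

lemma power_concave_PiMD:
  assumes "power_concave_PiM q I K" "u > 0" "v > 0" "u + v = 1" "a > 0" "b > 0"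
    "w \<in> extensional I" "z \<in> extensional I"
    "ennreal (a powr -q) < K x w" "ennreal (b powr -q) < K y z"
    "u *\<^sub>R x + v *\<^sub>R y = xy" "(\<lambda>i. u * w i + v * z i) = wz"
  shows "ennreal ((u * a + v * b) powr -q) < K xy wz"
  using assms unfolding power_concave_PiM_def by blast

text \<open>Induction on \<open>I\<close>: integrating out one coordinate lowers the order by one,
  and \<open>q > card I\<close> keeps the order above 1 each time a coordinate is removed.\<close>

lemma power_concave_integral_PiM:
  fixes K :: "'p::real_vector \<Rightarrow> ('i \<Rightarrow> real) \<Rightarrow> ennreal"
  assumes "finite I" "\<And>x. K x \<in> borel_measurable (\<Pi>\<^sub>M i\<in>I. lborel)"
    and "power_concave_PiM q I K" "q > card I"
  shows "power_concave (q - card I) (\<lambda>x. \<integral>\<^sup>+w. K x w \<partial>(\<Pi>\<^sub>M i\<in>I. lborel))"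
  using assms
proof (induction I arbitrary: K q rule: finite_induct)
  case empty
  interpret product_sigma_finite "\<lambda>i::'i. lborel :: real measure"
    by (simp add: product_sigma_finite_def lborel.sigma_finite_measure_axioms)
  \<comment> \<open>Over the empty index set the only point is the constant
    \<open>undefined\<close>; \<open>u + v = 1\<close> makes it a convex combination of
    itself.\<close>
  have "(\<lambda>i::'i. u * undefined + v * undefined) = (\<lambda>i. undefined :: real)"
    if "u + v = 1" for u v :: real
    using that by (simp add: distrib_right[symmetric])
  then show ?case
    using empty(2) unfolding power_concave_def power_concave_PiM_def
    by (simp add: PiM_empty nn_integral_count_space_finite)
next
  case (insert i I)
  interpret product_sigma_finite "\<lambda>i::'i. lborel :: real measure"
    by (simp add: product_sigma_finite_def lborel.sigma_finite_measure_axioms)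
  note [measurable] = insert.prems(1)
  define K1 where "K1 = (\<lambda>x w. \<integral>\<^sup>+s. K x (w(i := s)) \<partial>lborel)"
  have q: "q - 1 > card I" "q > 1" using insert by auto
  have meas: "(\<lambda>s. K x (w(i := s))) \<in> borel_measurable borel" if "w \<in> extensional I" for x w
  proof -
    have "w \<in> space (\<Pi>\<^sub>M i\<in>I. lborel)" using that by (auto simp: space_PiM PiE_def)
    then have "(\<lambda>s. K x (w(i := s))) \<in> borel_measurable lborel"
      by (rule measurable_compose[OF measurable_component_update[OF _ insert.hyps(2)] insert.prems(1)])
    then show ?thesis by (simp del: fun_upd_apply)
  qed
  have ext: "w(i := s) \<in> extensional (insert i I)" if "w \<in> extensional I" for w and s :: real
    using that by (auto simp: extensional_def)
  \<comment> \<open>Joint power concavity, used with the same \<open>x\<close>, \<open>w\<close> and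
    level on both sides.\<close>
  have conv: "convex {s. ennreal c < K x (w(i := s))}" if c: "c > 0" and w: "w \<in> extensional I" for c x w
  proof -
    define a where "a = c powr (-1 / q)"
    have a: "a > 0" "a powr -q = c" using c q by (auto simp: a_def powr_powr)
    show ?thesis
    proof (rule convexI)
      fix s t u v :: real
      assume s: "s \<in> {s. ennreal c < K x (w(i := s))}" and t: "t \<in> {s. ennreal c < K x (w(i := s))}"
        and uv: "0 \<le> u" "0 \<le> v" "u + v = 1"
      show "u *\<^sub>R s + v *\<^sub>R t \<in> {s. ennreal c < K x (w(i := s))}"
      proof (cases "u = 0 \<or> v = 0")
        case True
        then show ?thesis using s t uv by auto
      next
        case False
        have comb: "u *\<^sub>R x + v *\<^sub>R x = x" "u * a + v * a = a" "u * y + v * y = y" for y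
          using uv by (simp_all add: distrib_right[symmetric] scaleR_add_left[symmetric])
        have "ennreal ((u * a + v * a) powr -q) < K x (w(i := u * s + v * t))"
        proof (rule power_concave_PiMD[OF insert.prems(2), of _ _ _ _ "w(i := s)" "w(i := t)" x x])
          show "(\<lambda>j. u * (w(i := s)) j + v * (w(i := t)) j) = w(i := u * s + v * t)"
            using comb by auto
        qed (use False uv a s t comb w in \<open>auto intro: ext simp del: fun_upd_apply\<close>)
        then show ?thesis using comb a by simp
      qed
    qed
  qed
  have "power_concave_PiM (q - 1) I K1"
    unfolding power_concave_PiM_def K1_def
  proof (intro allI impI)
    fix x y :: 'p and w z and u v a b :: real
    assume wz: "w \<in> extensional I" "z \<in> extensional I"
      and uv: "0 < u" "0 < v" "u + v = 1" and ab: "0 < a" "0 < b"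
      and less: "ennreal (a powr -(q - 1)) < (\<integral>\<^sup>+s. K x (w(i := s)) \<partial>lborel)"
        "ennreal (b powr -(q - 1)) < (\<integral>\<^sup>+s. K y (z(i := s)) \<partial>lborel)"
    have ext': "(\<lambda>i. u * w i + v * z i) \<in> extensional I"
      using wz uv by (auto simp: extensional_def distrib_right[symmetric])
    show "ennreal ((u * a + v * b) powr -(q - 1)) <
       (\<integral>\<^sup>+s. K (u *\<^sub>R x + v *\<^sub>R y) ((\<lambda>i. u * w i + v * z i)(i := s)) \<partial>lborel)"
    proof (rule marginal_power_concave_real[OF meas meas meas q(2) uv(1,2) ab conv conv _ less])
      fix s t a b :: real
      assume ab': "a > 0" "b > 0" "ennreal (a powr - q) < K x (w(i := s))" "ennreal (b powr - q) < K y (z(i := t))"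
      show "ennreal ((u * a + v * b) powr - q) < K (u *\<^sub>R x + v *\<^sub>R y)
            ((\<lambda>i. u * w i + v * z i)(i := u * s + v * t))"
      proof (rule power_concave_PiMD[OF insert.prems(2), of _ _ _ _ "w(i := s)" "z(i := t)" x y])
        show "(\<lambda>j. u * (w(i := s)) j + v * (z(i := t)) j) = (\<lambda>i. u * w i + v * z i)(i := u * s + v * t)"
          by auto
      qed (use uv wz ab' in \<open>auto intro: ext simp del: fun_upd_apply\<close>)
    qed (use wz ext' in auto)
  qed
  moreover have "K1 x \<in> borel_measurable (\<Pi>\<^sub>M i\<in>I. lborel)" for x
    unfolding K1_def by measurable
  ultimately have "power_concave (q - 1 - card I) (\<lambda>x. \<integral>\<^sup>+w. K1 x w \<partial>(\<Pi>\<^sub>M i\<in>I. lborel))"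
    using q by (intro insert.IH)
  then show ?case
    using insert.hyps by (simp add: K1_def product_nn_integral_insert[OF _ _ insert.prems(1)] algebra_simps del: fun_upd_apply)
qed

text \<open>The coordinate map \<open>T\<close> is linear and carries the product of one-dimensional
  Lebesgue measures to \<open>lborel\<close>, which reduces the claim to integration over
  coordinates.\<close>

theorem power_concave_integral:
  fixes K :: "'p::real_vector \<times> 'a::euclidean_space \<Rightarrow> ennreal"
  assumes meas[measurable]: "\<And>x. (\<lambda>y. K (x, y)) \<in> borel_measurable borel"
    and conc: "power_concave q K" and q: "q > DIM('a)"
  shows "power_concave (q - DIM('a)) (\<lambda>x. \<integral>\<^sup>+y. K (x, y) \<partial>lborel)"
proof -
  define T where "T = (\<lambda>w :: 'a \<Rightarrow> real. \<Sum>b\<in>Basis. w b *\<^sub>R b)"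
  have T[measurable]: "T \<in> borel_measurable (\<Pi>\<^sub>M b\<in>Basis. lborel)"
    unfolding T_def by measurable
  have distr: "lborel = distr (\<Pi>\<^sub>M b\<in>Basis. lborel) borel T"
    unfolding T_def lborel_eq_real by (simp add: lborel_def)
  have "power_concave_PiM q Basis (\<lambda>x w. K (x, T w))"
    unfolding power_concave_PiM_def
  proof (intro allI impI)
    fix x y :: 'p and w z :: "'a \<Rightarrow> real" and u v a b :: real
    assume uv: "0 < u" "0 < v" "u + v = 1" "0 < a" "0 < b"
      "ennreal (a powr - q) < K (x, T w)" "ennreal (b powr - q) < K (y, T z)"
    have "T (\<lambda>i. u * w i + v * z i) = u *\<^sub>R T w + v *\<^sub>R T z"
      by (simp add: T_def scaleR_sum_right sum.distrib scaleR_add_left)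
    then show "ennreal ((u * a + v * b) powr - q) < K (u *\<^sub>R x + v *\<^sub>R y, T (\<lambda>i. u * w i + v * z i))"
      using power_concaveD[OF conc uv] by simp
  qed
  then have "power_concave (q - DIM('a)) (\<lambda>x. \<integral>\<^sup>+w. K (x, T w) \<partial>(\<Pi>\<^sub>M b\<in>Basis. lborel))"
    using q by (intro power_concave_integral_PiM) auto
  then show ?thesis by (subst distr) (simp add: nn_integral_distr)
qed

text \<open>Power concavity with \<open>a = b\<close> preserves a level of the form
  \<open>a powr -r\<close>. A value strictly between \<open>c\<close> and
  \<open>min (F x) (F y)\<close> is finite and positive, hence of this form, even for
  \<open>c = 0\<close>.\<close>

lemma convex_power_concave_superlevel:
  assumes "power_concave r F" "r > 0"
  shows "convex {x. c < F x}"
proof (rule convexI)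
  fix x y and u v :: real
  assume x: "x \<in> {x. c < F x}" and y: "y \<in> {x. c < F x}" and uv: "0 \<le> u" "0 \<le> v" "u + v = 1"
  have "c < min (F x) (F y)" using x y by simp
  then obtain d where d: "c < d" "d < min (F x) (F y)" using dense by blast
  then obtain e where e: "0 \<le> e" "d = ennreal e"
    by (metis ennreal_cases not_top_less)
  then have "e > 0" using d by (cases "e = 0") auto
  define a where "a = e powr (-1 / r)"
  have a: "a > 0" "a powr -r = e" using \<open>e > 0\<close> assms(2) by (auto simp: a_def powr_powr)
  show "u *\<^sub>R x + v *\<^sub>R y \<in> {x. c < F x}"
  proof (cases "u = 0 \<or> v = 0")
    case True
    then show ?thesis using x y uv by auto
  next
    case False
    have "ennreal ((u * a + v * a) powr -r) < F (u *\<^sub>R x + v *\<^sub>R y)"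
      using False uv a d e by (intro power_concaveD[OF assms(1)]) auto
    also have "u * a + v * a = a" using uv by (simp add: distrib_right[symmetric])
    finally show ?thesis using d a e by simp
  qed
qed

section \<open>The norm and power concavity of the kernel\<close>

lemma is_norm_convex_on:
  assumes "is_norm \<N>"
  shows "convex_on UNIV \<N>"
proof (rule convex_onI)
  fix t :: real and x y assume "0 < t" "t < 1"
  have "\<N> ((1 - t) *\<^sub>R x + t *\<^sub>R y) \<le> \<N> ((1 - t) *\<^sub>R x) + \<N> (t *\<^sub>R y)"
    using assms unfolding is_norm_def by blast
  also have "\<dots> = \<bar>1 - t\<bar> * \<N> x + \<bar>t\<bar> * \<N> y"
    using assms unfolding is_norm_def by presburger
  finally show "\<N> ((1 - t) *\<^sub>R x + t *\<^sub>R y) \<le> (1 - t) * \<N> x + t * \<N> y"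
    using \<open>0 < t\<close> \<open>t < 1\<close> by simp
qed simp

lemma is_norm_continuous_on:
  fixes \<N> :: "'a::euclidean_space \<Rightarrow> real"
  assumes "is_norm \<N>"
  shows "continuous_on UNIV \<N>"
  using is_norm_convex_on[OF assms] by (intro convex_on_continuous) auto

text \<open>By compactness \<open>\<N>\<close> attains a minimum on the Euclidean unit sphere, which
  is positive; homogeneity extends the bound. It serves the integrability of the kernel.\<close>

lemma is_norm_ge_norm:
  fixes \<N> :: "'a::euclidean_space \<Rightarrow> real"
  assumes N: "is_norm \<N>"
  obtains c where "c > 0" "\<And>x. c * norm x \<le> \<N> x"
proof -
  have "continuous_on (sphere 0 1) \<N>"
    using is_norm_continuous_on[OF N] continuous_on_subset by blast
  moreover have "sphere (0::'a) 1 \<noteq> {}" by simp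
  ultimately obtain z where z: "z \<in> sphere 0 1" "\<And>y. y \<in> sphere 0 1 \<Longrightarrow> \<N> z \<le> \<N> y"
    using continuous_attains_inf[OF compact_sphere] by blast
  have "z \<noteq> 0" using z(1) by auto
  then have "\<N> z > 0" using N by (simp add: is_norm_def order.strict_iff_order)
  moreover have "\<N> z * norm x \<le> \<N> x" for x
  proof (cases "x = 0")
    case False
    have "\<N> z \<le> \<N> (inverse (norm x) *\<^sub>R x)" using False by (intro z) simp
    also have "\<dots> = inverse (norm x) * \<N> x" using N by (simp add: is_norm_def)
    finally show ?thesis using False by (simp add: field_simps)
  qed (use N in \<open>simp add: is_norm_def\<close>)
  ultimately show ?thesis using that by blast
qed

text \<open>The power \<open>-1/p\<close> of the kernel is a multiple of the \<open>l^p\<close> norm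
  of the pair of \<open>1\<close> and \<open>\<N> (b *\<^sub>R x)\<close>. Its convexity combines
  that of \<open>\<N>\<close> with Minkowski's inequality, obtained by adding two instances of
  \<open>weighted_powr_le\<close> with the same weights, one for each component.\<close>

lemma power_concave_norm_kernel:
  assumes N: "is_norm \<N>" and p: "p \<ge> 1" and A: "A > 0"
  shows "power_concave p (\<lambda>x. ennreal (A / (1 + \<N> (b *\<^sub>R x) powr p)))"
  unfolding power_concave_def
proof (intro allI impI)
  fix x y and u v a c :: real
  assume uv: "0 < u" "0 < v" "u + v = 1" and ac: "0 < a" "0 < c"
    and less: "ennreal (a powr -p) < ennreal (A / (1 + \<N> (b *\<^sub>R x) powr p))"
      "ennreal (c powr -p) < ennreal (A / (1 + \<N> (b *\<^sub>R y) powr p))"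
  define D where "D = u * a + v * c"
  have D: "D > 0" using uv ac by (simp add: D_def add_pos_pos)
  have N0: "\<N> z \<ge> 0" for z using N by (simp add: is_norm_def)
  have iff: "ennreal (d powr -p) < ennreal (A / (1 + r powr p)) \<longleftrightarrow> 1 + r powr p < A * d powr p"
    if "d > 0" for d r :: real
  proof -
    have "1 + r powr p > 0" using powr_ge_zero[of r p] by linarith
    then show ?thesis using that A by (simp add: ennreal_less_iff powr_minus field_simps)
  qed
  \<comment> \<open>Raising \<open>r\<close> to \<open>r'\<close> turns the strict inequality into
    an equation, so that the two Jensen bounds add up exactly; it also gives \<open>r' > 0\<close>,
    as \<open>weighted_powr_le\<close> asks, when the norm vanishes.\<close>
  have bound: "\<exists>r'. r' > 0 \<and> r < r' \<and> 1 + r' powr p = A * d powr p"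
    if "r \<ge> 0" "1 + r powr p < A * d powr p" for r d :: real
  proof (intro exI conjI)
    let ?r = "(A * d powr p - 1) powr (1 / p)"
    have pos: "A * d powr p - 1 > 0" using that powr_ge_zero[of r p] by linarith
    show "1 + ?r powr p = A * d powr p" using pos p by (simp add: powr_powr)
    show "?r > 0" using pos by simp
    have "r = (r powr p) powr (1 / p)" using that p by (simp add: powr_powr)
    also have "\<dots> < ?r" using that p by (intro powr_less_mono2) auto
    finally show "r < ?r" .
  qed
  obtain r where r: "r > 0" "\<N> (b *\<^sub>R x) < r" "1 + r powr p = A * a powr p"
    using bound[OF N0] less(1) iff[OF ac(1)] by blast
  obtain s where s: "s > 0" "\<N> (b *\<^sub>R y) < s" "1 + s powr p = A * c powr p"
    using bound[OF N0] less(2) iff[OF ac(2)] by blast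
  have "\<N> (b *\<^sub>R (u *\<^sub>R x + v *\<^sub>R y)) = \<N> (u *\<^sub>R (b *\<^sub>R x) + v *\<^sub>R (b *\<^sub>R y))"
    by (simp add: scaleR_add_right mult.commute)
  also have "\<dots> \<le> \<N> (u *\<^sub>R (b *\<^sub>R x)) + \<N> (v *\<^sub>R (b *\<^sub>R y))"
    using N unfolding is_norm_def by blast
  also have "\<dots> = u * \<N> (b *\<^sub>R x) + v * \<N> (b *\<^sub>R y)"
  proof -
    have "\<N> (t *\<^sub>R z) = \<bar>t\<bar> * \<N> z" for t z using N unfolding is_norm_def by blast
    then show ?thesis using uv by (simp add: abs_mult algebra_simps)
  qed
  also have "\<dots> < u * r + v * s"
    using uv r s by (intro add_strict_mono mult_strict_left_mono) auto
  finally have "\<N> (b *\<^sub>R (u *\<^sub>R x + v *\<^sub>R y)) powr p < (u * r + v * s) powr p"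
    using N0 p by (intro powr_less_mono2) auto
  also have "\<dots> \<le> D powr (p - 1) * (u * a * (r / a) powr p + v * c * (s / c) powr p)"
    unfolding D_def using uv ac r s p by (intro weighted_powr_le) auto
  finally have 1: "\<N> (b *\<^sub>R (u *\<^sub>R x + v *\<^sub>R y)) powr p <
      D powr (p - 1) * (u * a * (r / a) powr p + v * c * (s / c) powr p)" .
  \<comment> \<open>The component \<open>1\<close> of the pair.\<close>
  have "(u * 1 + v * 1) powr p \<le> D powr (p - 1) * (u * a * (1 / a) powr p + v * c * (1 / c) powr p)"
    unfolding D_def using uv ac p by (intro weighted_powr_le) auto
  then have 2: "1 \<le> D powr (p - 1) * (u * a * (1 / a) powr p + v * c * (1 / c) powr p)"
    using uv by simp
  have eq: "u * a * (1 / a) powr p + u * a * (r / a) powr p = u * a * A"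
    if "a > 0" "r > 0" "1 + r powr p = A * a powr p" for u a r :: real
  proof -
    have "u * a * (1 / a) powr p + u * a * (r / a) powr p = u * a * ((1 + r powr p) / a powr p)"
      using that(1,2) by (simp add: powr_divide add_divide_distrib distrib_left)
    also have "\<dots> = u * a * A" unfolding that(3) using that(1) by simp
    finally show ?thesis .
  qed
  have "1 + \<N> (b *\<^sub>R (u *\<^sub>R x + v *\<^sub>R y)) powr p < D powr (p - 1) *
      ((u * a * (1 / a) powr p + u * a * (r / a) powr p) + (v * c * (1 / c) powr p + v * c * (s / c) powr p))"
    using 1 2 by (simp add: distrib_left)
  also have "\<dots> = D powr (p - 1) * (D * A)"
    using eq[OF ac(1) r(1,3)] eq[OF ac(2) s(1,3)] by (simp add: D_def distrib_right)
  also have "\<dots> = A * D powr p"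
    using D by (simp add: powr_diff)
  finally show "ennreal ((u * a + v * c) powr -p) < ennreal (A / (1 + \<N> (b *\<^sub>R (u *\<^sub>R x + v *\<^sub>R y)) powr p))"
    using iff[OF D] by (simp add: D_def)
qed

section \<open>Integrability of power decay\<close>

text \<open>On the smallest ball of radius \<open>2^n / k\<close> containing \<open>x\<close> the
  integrand is at most \<open>2^p * 2^(-p n)\<close>. Ball volumes grow like \<open>2^(n d)\<close>
  with \<open>d\<close> the dimension, so the bounds sum to a geometric series of ratio
  \<open>2^(d - p) < 1\<close>.\<close>

lemma nn_integral_norm_powr_finite:
  fixes k p :: real
  assumes k: "k > 0" and p: "p > DIM('a)"
  shows "(\<integral>\<^sup>+x. ennreal (1 / (1 + (k * norm (x :: 'a::euclidean_space)) powr p)) \<partial>lborel) < top"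
proof -
  let ?B = "\<lambda>n::nat. cball (0::'a) (2 ^ n / k)"
  \<comment> \<open>The factor \<open>2 powr p\<close> arises because, for positive
    \<open>n\<close>, minimality of \<open>n\<close> gives
    \<open>k * norm x > 2 ^ (n - 1)\<close>.\<close>
  let ?c = "\<lambda>n::nat. 2 powr p * (2 powr -p) ^ n"
  let ?d = "real DIM('a)"
  have "ennreal (1 / (1 + (k * norm x) powr p)) \<le> (\<Sum>n. ennreal (?c n) * indicator (?B n) x)" for x :: 'a
  proof -
    have "\<exists>n. k * norm x \<le> 2 ^ n"
      using real_arch_pow[of 2 "k * norm x"] by (auto intro: less_imp_le)
    define n where "n = (LEAST n. k * norm x \<le> 2 ^ n)"
    have n: "k * norm x \<le> 2 ^ n" unfolding n_def by (rule LeastI_ex) fact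
    have pos: "1 + (k * norm x) powr p > 0" using powr_ge_zero[of "k * norm x" p] by linarith
    have "1 / (1 + (k * norm x) powr p) \<le> ?c n"
    proof (cases n)
      case 0
      have "1 / (1 + (k * norm x) powr p) \<le> 1" using pos by (simp add: divide_le_eq)
      also have "1 \<le> 2 powr p" using p by (intro ge_one_powr_ge_zero) auto
      finally show ?thesis using 0 by simp
    next
      case (Suc m)
      have "\<not> k * norm x \<le> 2 ^ m"
        using not_less_Least[of m "\<lambda>n. k * norm x \<le> 2 ^ n"] Suc by (simp add: n_def)
      then have "(2 ^ m) powr p \<le> (k * norm x) powr p"
        using p by (intro powr_mono2) auto
      then have "1 / (1 + (k * norm x) powr p) \<le> 1 / (2 ^ m) powr p"
        by (intro divide_left_mono) (auto intro!: mult_pos_pos pos)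
      also have "\<dots> = ?c n"
        by (simp add: Suc powr_realpow[symmetric] powr_powr powr_minus powr_power field_simps)
      finally show ?thesis .
    qed
    then have "ennreal (1 / (1 + (k * norm x) powr p)) \<le> ennreal (?c n) * indicator (?B n) x"
      using n k by (simp add: field_simps ennreal_leI)
    also have "\<dots> = (\<Sum>i\<in>{n}. ennreal (?c i) * indicator (?B i) x)"
      by (simp only: sum.insert finite.emptyI empty_iff not_False_eq_True sum.empty add_0_right)
    also have "\<dots> \<le> (\<Sum>n. ennreal (?c n) * indicator (?B n) x)"
      by (intro sum_le_suminf) auto
    finally show ?thesis .
  qed
  then have "(\<integral>\<^sup>+x. ennreal (1 / (1 + (k * norm (x :: 'a)) powr p)) \<partial>lborel) \<le>
      (\<integral>\<^sup>+x. (\<Sum>n. ennreal (?c n) * indicator (?B n) x) \<partial>lborel)"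
    by (intro nn_integral_mono)
  also have "\<dots> = (\<Sum>n. \<integral>\<^sup>+x. ennreal (?c n) * indicator (?B n) x \<partial>lborel)"
    by (intro nn_integral_suminf borel_measurable_times_ennreal borel_measurable_const borel_measurable_indicator) simp
  also have "\<dots> = (\<Sum>n. ennreal (?c n) * emeasure lborel (?B n))"
    by (intro suminf_cong nn_integral_cmult_indicator) simp
  also have "\<dots> = (\<Sum>n. ennreal (2 powr p * unit_ball_vol ?d / k ^ DIM('a) * (2 powr (?d - p)) ^ n))"
  proof (rule suminf_cong)
    fix n
    have "(2 powr (?d - p)) ^ n = (2 powr -p) ^ n * (2 ^ n) ^ DIM('a)"
    proof -
      have 1: "2 powr (?d - p) = 2 powr -p * 2 powr ?d" by (metis add.commute powr_add uminus_add_conv_diff)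
      have 2: "2 powr ?d = 2 ^ DIM('a)" by (rule powr_realpow) simp
      show ?thesis unfolding 1 2 power_mult_distrib by (simp only: power_mult[symmetric] mult.commute)
    qed
    moreover have "ennreal (?c n) * emeasure lborel (?B n) =
        ennreal (?c n * (unit_ball_vol ?d * ((2 ^ n) ^ DIM('a) / k ^ DIM('a))))"
      unfolding power_divide[symmetric] using k
      by (subst emeasure_cball) (auto intro!: ennreal_mult[symmetric])
    moreover have "P * W * (V * (M / L)) = P * V / L * (W * M)" for P W V M L :: real
      by simp
    ultimately show "ennreal (?c n) * emeasure lborel (?B n) =
        ennreal (2 powr p * unit_ball_vol ?d / k ^ DIM('a) * (2 powr (?d - p)) ^ n)"
      by (simp only:)
  qed
  also have "\<dots> < top"
  proof -
    have "2 powr (?d - p) < 2 powr 0" using p by (intro powr_less_mono) auto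
    then have "summable (\<lambda>n. 2 powr p * unit_ball_vol ?d / k ^ DIM('a) * (2 powr (?d - p)) ^ n)"
      by (intro summable_mult summable_geometric) simp
    then show ?thesis
      using k by (subst suminf_ennreal2) auto
  qed
  finally show ?thesis .
qed

section \<open>Superlevel sets of the convolution\<close>

text \<open>The convolution is twice the integral \<open>F\<close> of \<open>J\<close> against the
  indicator of \<open>S\<close>, minus the total mass \<open>I\<close>, and \<open>F\<close> is a
  marginal of the jointly power concave \<open>K\<close>. Equality almost everywhere admits the
  initial function of the scheme; the measurability conclusion allows iteration.\<close>

lemma convex_superlevel_convolve:
  fixes J :: "real ^ 'n \<Rightarrow> real" and S :: "(real ^ 'n) set"
  assumes J[measurable]: "J \<in> borel_measurable borel" and J0: "\<And>x. J x \<ge> 0"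
    and Jint: "integrable lborel J"
    and conc: "power_concave q (\<lambda>x. ennreal (J x))" and q: "q > CARD('n)"
    and S[measurable]: "S \<in> sets borel" and "convex S"
    and w[measurable]: "w \<in> borel_measurable borel"
    and AE: "AE y in lborel. w y = indicator S y - indicator (- S) y"
  shows "convex {x. c < convolve J w x}" and "{x. c < convolve J w x} \<in> sets borel"
proof -
  define K where "K = (\<lambda>(x, y). ennreal (J (x - y)) * indicator S y)"
  define F where "F = (\<lambda>x. \<integral>\<^sup>+y. K (x, y) \<partial>lborel)"
  define I where "I = (\<integral>x. J x \<partial>lborel)"
  have refl: "distr lborel borel (\<lambda>y. x - y) = lborel" for x :: "real ^ 'n"
    using lborel_affine[of "-1" x] by (simp add: density_1)
  have int: "integrable lborel (\<lambda>y. J (x - y))" for x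
    using integrable_distr_eq[of "\<lambda>y. x - y" lborel borel J] Jint by (simp add: refl)
  have I: "(\<integral>y. J (x - y) \<partial>lborel) = I" for x
    using integral_distr[of "\<lambda>y. x - y" lborel borel J] by (simp add: refl I_def)
  have intS: "integrable lborel (\<lambda>y. J (x - y) * indicator S y)" for x
    using integrable_real_mult_indicator[OF _ int] by simp
  have F: "F x = ennreal (\<integral>y. J (x - y) * indicator S y \<partial>lborel)" for x
    unfolding F_def K_def using intS J0
    by (subst nn_integral_eq_integral[symmetric]) (auto simp: ennreal_mult' ennreal_indicator)
  have conv: "convolve J w x = 2 * (\<integral>y. J (x - y) * indicator S y \<partial>lborel) - I" for x
  proof -
    have "convolve J w x = (\<integral>y. 2 * (J (x - y) * indicator S y) - J (x - y) \<partial>lborel)"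
      unfolding convolve_def
      using AE by (intro integral_cong_AE) (auto simp: indicator_def)
    then show ?thesis using int intS by (simp add: I)
  qed
  \<comment> \<open>The difference \<open>x - y\<close> is linear in the pair, and the indicator
    confines \<open>y\<close> to the convex set \<open>S\<close>.\<close>
  have "power_concave q K"
    unfolding power_concave_def
  proof (intro allI impI)
    fix z z' :: "(real ^ 'n) \<times> (real ^ 'n)" and u v a b :: real
    assume uv: "0 < u" "0 < v" "u + v = 1" "0 < a" "0 < b"
      and less: "ennreal (a powr - q) < K z" "ennreal (b powr - q) < K z'"
    obtain x y x' y' where z: "z = (x, y)" "z' = (x', y')" by fastforce
    have S: "y \<in> S" "y' \<in> S" using less by (cases "y \<in> S"; cases "y' \<in> S"; simp add: z K_def)+
    then have "u *\<^sub>R y + v *\<^sub>R y' \<in> S"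
      using \<open>convex S\<close> uv by (simp add: convex_def)
    moreover have "ennreal ((u * a + v * b) powr - q) < ennreal (J (u *\<^sub>R (x - y) + v *\<^sub>R (x' - y')))"
      using less S by (intro power_concaveD[OF conc uv]) (auto simp: z K_def)
    ultimately show "ennreal ((u * a + v * b) powr - q) < K (u *\<^sub>R z + v *\<^sub>R z')"
      by (simp add: z K_def algebra_simps)
  qed
  moreover have "(\<lambda>y. K (x, y)) \<in> borel_measurable borel" for x
    unfolding K_def by simp
  ultimately have pc: "power_concave (q - CARD('n)) F"
    using power_concave_integral[of K q] q by (simp add: F_def)
  have F_meas[measurable]: "F \<in> borel_measurable borel"
    unfolding F_def K_def by simp
  \<comment> \<open>\<open>ennreal\<close> sends negative reals to \<open>0\<close>, so
    \<open>c + I < 0\<close> is treated apart: there the superlevel set is the whole space.\<close>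
  have level: "{x. c < convolve J w x} = (if c + I < 0 then UNIV else {x. ennreal ((c + I) / 2) < F x})"
  proof -
    have iff: "c < 2 * Q - I \<longleftrightarrow> c + I < 0 \<or> ennreal ((c + I) / 2) < ennreal Q" if "Q \<ge> 0" for Q
      using that by (cases "c + I < 0") (auto simp: ennreal_less_iff field_simps)
    have "(\<integral>y. J (x - y) * indicator S y \<partial>lborel) \<ge> 0" for x
      using J0 by (intro integral_nonneg_AE) auto
    from iff[OF this] show ?thesis by (simp add: conv F)
  qed
  show "convex {x. c < convolve J w x}"
    unfolding level using convex_power_concave_superlevel[OF pc] q by simp
  show "{x. c < convolve J w x} \<in> sets borel"
    unfolding level by (auto intro!: borel_measurable_less)
qed

text \<open>These are the conditions that \<open>convex_superlevel_convolve\<close> puts on the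
  kernel. The decay exponent \<open>CARD('n) + \<alpha>\<close> exceeds the dimension, which gives
  integrability, and is also the order of power concavity.\<close>

lemma J_kernel_props:
  fixes \<N> :: "real ^ 'n \<Rightarrow> real" and \<alpha> h :: real
  assumes N: "is_norm \<N>" and \<alpha>: "\<alpha> \<ge> 1" and h: "h > 0"
  shows "J_kernel \<N> \<alpha> h \<in> borel_measurable borel"
    and "\<And>x. J_kernel \<N> \<alpha> h x \<ge> 0"
    and "integrable lborel (J_kernel \<N> \<alpha> h)"
    and "power_concave (CARD('n) + \<alpha>) (\<lambda>x. ennreal (J_kernel \<N> \<alpha> h x))"
proof -
  define t where "t = sigma \<alpha> h"
  define A where "A = t powr (- real CARD('n) / \<alpha>)"
  define b where "b = t powr (- 1 / \<alpha>)"
  define p where "p = CARD('n) + \<alpha>"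
  have "t > 0" using sigma_one(1)[OF h] h by (cases "\<alpha> = 1") (auto simp: t_def sigma_def[of \<alpha>])
  then have A: "A > 0" and b: "b > 0" by (auto simp: A_def b_def)
  have p: "p \<ge> 1" "p > DIM(real ^ 'n)" using \<alpha> by (auto simp: p_def)
  have J: "J_kernel \<N> \<alpha> h = (\<lambda>x. A / (1 + \<N> (b *\<^sub>R x) powr p))"
    by (simp add: fun_eq_iff J_kernel_def p_kernel_def P_kernel_def A_def b_def p_def t_def)
  have [measurable]: "\<N> \<in> borel_measurable borel"
    using is_norm_continuous_on[OF N] by (rule borel_measurable_continuous_onI)
  show meas: "J_kernel \<N> \<alpha> h \<in> borel_measurable borel"
    unfolding J by measurable
  show nonneg: "J_kernel \<N> \<alpha> h x \<ge> 0" for x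
    unfolding J using A by (intro divide_nonneg_nonneg add_nonneg_nonneg) auto
  show "power_concave (CARD('n) + \<alpha>) (\<lambda>x. ennreal (J_kernel \<N> \<alpha> h x))"
    unfolding J p_def[symmetric] by (rule power_concave_norm_kernel[OF N p(1) A])
  obtain c where c: "c > 0" "\<And>x. c * norm x \<le> \<N> x" using is_norm_ge_norm[OF N] by blast
  have le: "J_kernel \<N> \<alpha> h x \<le> A * (1 / (1 + (c * b * norm x) powr p))" for x
  proof -
    have "(c * b * norm x) powr p \<le> \<N> (b *\<^sub>R x) powr p"
      using c(2)[of "b *\<^sub>R x"] c(1) b p by (intro powr_mono2) (auto simp: mult_ac)
    then have "A / (1 + \<N> (b *\<^sub>R x) powr p) \<le> A / (1 + (c * b * norm x) powr p)"
      using A by (intro divide_left_mono mult_pos_pos add_pos_nonneg) auto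
    then show ?thesis by (simp add: J)
  qed
  have "(\<integral>\<^sup>+x. ennreal (J_kernel \<N> \<alpha> h x) \<partial>lborel) \<le>
      (\<integral>\<^sup>+x. ennreal A * ennreal (1 / (1 + (c * b * norm (x :: real ^ 'n)) powr p)) \<partial>lborel)"
  proof (rule nn_integral_mono)
    show "ennreal (J_kernel \<N> \<alpha> h x) \<le> ennreal A * ennreal (1 / (1 + (c * b * norm x) powr p))" for x
      using ennreal_leI[OF le[of x]] A by (simp only: ennreal_mult' less_imp_le)
  qed
  also have "\<dots> = ennreal A * (\<integral>\<^sup>+x. ennreal (1 / (1 + (c * b * norm (x :: real ^ 'n)) powr p)) \<partial>lborel)"
    by (intro nn_integral_cmult) simp
  also have "\<dots> < top"
    using nn_integral_norm_powr_finite[where 'a = "real ^ 'n", of "c * b" p] b c p by (simp add: ennreal_mult_less_top)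
  finally show "integrable lborel (J_kernel \<N> \<alpha> h)"
    using meas nonneg by (intro integrableI_nonneg) auto
qed

section \<open>Convexity along the scheme\<close>

text \<open>The initial function is \<open>0\<close> on the frontier of \<open>\<Omega>0\<close>,
  where the difference of indicators is \<open>-1\<close>; the frontier of a convex set is null.
  From the first step on equality holds everywhere.\<close>

lemma scheme_u_eq_indicator_AE:
  fixes \<Omega>0 :: "(real ^ 'n) set"
  assumes "open \<Omega>0" "convex \<Omega>0"
  shows "AE y in lborel. scheme_u \<N> \<alpha> g \<Omega>0 h n y =
    indicator (scheme_set \<N> \<alpha> g \<Omega>0 h n) y - indicator (- scheme_set \<N> \<alpha> g \<Omega>0 h n) y"
proof (cases n)
  case 0
  have "frontier \<Omega>0 \<in> null_sets lborel"
    using negligible_convex_frontier[OF assms(2)]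
    by (simp add: negligible_iff_null_sets null_sets_completion_iff)
  then have "AE y in lborel. y \<notin> frontier \<Omega>0" by (rule AE_not_in)
  then show ?thesis
    by eventually_elim (auto simp: 0 frontier_def interior_open[OF assms(1)] indicator_def
        dest: subsetD[OF closure_subset])
next
  case (Suc m)
  then show ?thesis by (intro AE_I2 scheme_u_eq_indicator) simp
qed

theorem corollary5p3:
  fixes \<N> :: "real ^ 'n \<Rightarrow> real"
    and \<Omega>0 :: "(real ^ 'n) set"
    and \<alpha> h :: real
    and g :: "real \<Rightarrow> real"
    and n :: nat
  assumes "CARD('n) \<ge> 2"
    and "is_norm \<N>"
    and "open \<Omega>0" and "convex \<Omega>0"
    and "1 \<le> \<alpha>" and "\<alpha> < 2"
    and "continuous_on {0..} g"
    and "h > 0"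
  shows "convex (scheme_set \<N> \<alpha> g \<Omega>0 h n)"
proof -
  note J = J_kernel_props[OF assms(2,5,8)]
  \<comment> \<open>The induction also carries Borel measurability, which the convolution lemma
    requires of the current set.\<close>
  have "convex (scheme_set \<N> \<alpha> g \<Omega>0 h n) \<and> scheme_set \<N> \<alpha> g \<Omega>0 h n \<in> sets borel"
  proof (induction n)
    case 0
    then show ?case using assms by simp
  next
    case (Suc n)
    let ?S = "scheme_set \<N> \<alpha> g \<Omega>0 h n" and ?u = "scheme_u \<N> \<alpha> g \<Omega>0 h n"
    have S[measurable]: "?S \<in> sets borel" using Suc by simp
    have u: "?u \<in> borel_measurable borel"
    proof (cases n)
      case 0
      have [measurable]: "\<Omega>0 \<in> sets borel" using assms(3) by simp
      show ?thesis unfolding 0 scheme_u.simps by measurable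
    next
      case (Suc m)
      then have "?u = (\<lambda>x. indicator ?S x - indicator (- ?S) x)"
        by (intro ext scheme_u_eq_indicator) simp
      then show ?thesis by simp
    qed
    \<comment> \<open>The order left after integrating over all coordinates is
      \<open>\<alpha>\<close>, which is positive.\<close>
    show ?case
      unfolding scheme_set.simps
      using convex_superlevel_convolve[OF J _ S _ u scheme_u_eq_indicator_AE[OF assms(3,4)]]
        Suc assms(5) by simp
  qed
  then show ?thesis by simp
qed

end
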